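(* Let $X$ be an infinite set. Then $Top(X) \notin G_\delta^\beta$ for every ordinal $\beta \in \omega_1$.
   Context: $2^{\mathcal{P}(X)}$ is the set $\mathcal{P}(\mathcal{P}(X))$ of all families of subsets of $X$ with the product topology ($2=\{0,1\}$ discrete); a subbase of open sets is given by $A^+ = \{x : A \in x\}$ and $A^- = \{x : A \notin x\}$ for $A \subseteq X$. $Top(X) \subseteq 2^{\mathcal{P}(X)}$ is the set of all topologies on $X$. Define recursively the following classes of subsets of $2^{\mathcal{P}(X)}$: $G_\delta^0$ is the class of all $G_\delta$ sets; $G_{\delta\sigma}^0$ is the class of all countable unions of $G_\delta$ sets; for a successor ordinal $\beta$, $G_\delta^\beta$ is the class of all countable intersections of sets in $G_{\delta\sigma}^{\beta-1}$, and $G_{\delta\sigma}^\beta$ is the class of all countable unions of sets in $G_\delta^\beta$; for a limit ordinal $\gamma$, $G_\delta^\gamma = \bigcup_{\beta\in\gamma} G_\delta^\beta$ and $G_{\delta\sigma}^\gamma = \bigcup_{\beta\in\gamma} G_{\delta\sigma}^\beta$. *)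

theory Defs
  imports "HOL-Analysis.Analysis"
begin

section \<open>The ordinals below \<open>\<omega>\<^sub>1\<close>\<close>

text \<open>The well-order \<open>cardSuc natLeq\<close> is the initial ordinal of the successor cardinal of
  \<open>\<aleph>\<^sub>0\<close>, so the points of its field, in their order, are the ordinals \<open>\<beta> \<in> \<omega>\<^sub>1\<close>.
  The lemmas \<open>countable_initial_segment\<close> and \<open>uncountable_omega1\<close> below determine this
  well-order up to isomorphism.\<close>

lemma cardSuc_natLeq_Well_order: "Well_order (cardSuc natLeq)"
  using cardSuc_Well_order natLeq_Card_order by blast

lemma wo_rel_cardSuc_natLeq: "wo_rel (cardSuc natLeq)"
  using cardSuc_natLeq_Well_order by (simp add: wo_rel_def)

typedef omega1 = "Field (cardSuc natLeq)"
  using Field_cardSuc_not_empty[OF natLeq_Card_order] by auto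

instantiation omega1 :: wellorder
begin

definition less_eq_omega1 :: "omega1 \<Rightarrow> omega1 \<Rightarrow> bool"
  where "\<alpha> \<le> \<beta> \<longleftrightarrow> (Rep_omega1 \<alpha>, Rep_omega1 \<beta>) \<in> cardSuc natLeq"

definition less_omega1 :: "omega1 \<Rightarrow> omega1 \<Rightarrow> bool"
  where "(\<alpha> :: omega1) < \<beta> \<longleftrightarrow> \<alpha> \<le> \<beta> \<and> \<alpha> \<noteq> \<beta>"

instance
proof -
  let ?r = "cardSuc natLeq"
  note wo = wo_rel_cardSuc_natLeq
  have anti: "\<alpha> = \<beta>" if "\<alpha> \<le> \<beta>" "\<beta> \<le> \<alpha>" for \<alpha> \<beta> :: omega1
    using antisymD[OF wo_rel.ANTISYM[OF wo]] that
    by (simp add: less_eq_omega1_def flip: Rep_omega1_inject)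
  have wf': "wf (inv_image (?r - Id) Rep_omega1)"
    using wo_rel.WF[OF wo] by (rule wf_inv_image)
  show "OFCLASS(omega1, wellorder_class)"
  proof (intro_classes)
    fix \<alpha> \<beta> \<gamma> :: omega1
    show "\<alpha> < \<beta> \<longleftrightarrow> \<alpha> \<le> \<beta> \<and> \<not> \<beta> \<le> \<alpha>"
      unfolding less_omega1_def by (metis anti)
    have total: "\<alpha> \<le> \<beta> \<or> \<beta> \<le> \<alpha>" for \<alpha> \<beta> :: omega1
      unfolding less_eq_omega1_def
      using wo_rel.TOTALS[OF wo] Rep_omega1[of \<alpha>] Rep_omega1[of \<beta>] by simp
    then show "\<alpha> \<le> \<beta> \<or> \<beta> \<le> \<alpha>" .
    from total show "\<alpha> \<le> \<alpha>" by metis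
    show "\<alpha> \<le> \<gamma>" if "\<alpha> \<le> \<beta>" "\<beta> \<le> \<gamma>"
      using that unfolding less_eq_omega1_def by (rule transD[OF wo_rel.TRANS[OF wo]])
    show "\<alpha> = \<beta>" if "\<alpha> \<le> \<beta>" "\<beta> \<le> \<alpha>"
      using that by (rule anti)
  next
    fix P :: "omega1 \<Rightarrow> bool" and \<alpha>
    assume step: "\<And>\<beta>. (\<And>\<gamma>. \<gamma> < \<beta> \<Longrightarrow> P \<gamma>) \<Longrightarrow> P \<beta>"
    show "P \<alpha>"
      using wf'
    proof (induction \<alpha> rule: wf_induct_rule)
      case (less \<beta>)
      show ?case
      proof (rule step)
        fix \<gamma> assume "\<gamma> < \<beta>"
        then have "(\<gamma>, \<beta>) \<in> inv_image (?r - Id) Rep_omega1"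
          by (simp add: less_omega1_def less_eq_omega1_def Rep_omega1_inject)
        then show "P \<gamma>" by (rule less)
      qed
    qed
  qed
qed

end

lemma countable_iff_card_of_ordLeq: "countable A \<longleftrightarrow> (card_of A, natLeq) \<in> ordLeq"
  unfolding countable_def card_of_ordLeq[symmetric, of A "UNIV :: nat set", simplified]
  using card_of_nat ordLeq_ordIso_trans ordIso_symmetric card_of_ordLeq[of A "UNIV :: nat set"]
  by (metis subset_UNIV)

lemma countable_initial_segment: "countable {..<\<beta> :: omega1}"
proof -
  include cardinal_syntax
  let ?r = "cardSuc natLeq" and ?U = "underS (cardSuc natLeq) (Rep_omega1 \<beta>)"
  have "|?U| <o ?r"
    using card_of_underS[OF cardSuc_Card_order[OF natLeq_Card_order]] Rep_omega1 by blast
  then have "countable ?U"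
    using cardSuc_ordLeq_ordLess[OF natLeq_Card_order card_of_Card_order]
      countable_iff_card_of_ordLeq by blast
  moreover have "Rep_omega1 ` {..<\<beta>} \<subseteq> ?U"
    by (auto simp: less_omega1_def less_eq_omega1_def underS_def Rep_omega1_inject)
  ultimately have "countable (Rep_omega1 ` {..<\<beta>})"
    by (rule countable_subset[rotated])
  then show ?thesis
    by (rule countable_image_inj_on) (simp add: inj_on_def Rep_omega1_inject)
qed

lemma uncountable_omega1: "uncountable (UNIV :: omega1 set)"
proof
  include cardinal_syntax
  assume "countable (UNIV :: omega1 set)"
  then have "countable (Field (cardSuc natLeq))"
    using type_definition.Rep_range[OF type_definition_omega1] countable_image by metis
  then have "|Field (cardSuc natLeq)| \<le>o natLeq"
    by (simp add: countable_iff_card_of_ordLeq)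
  then have "cardSuc natLeq \<le>o natLeq"
    using card_of_Field_ordIso[OF cardSuc_Card_order[OF natLeq_Card_order]]
      ordIso_ordLeq_trans ordIso_symmetric by blast
  then show False
    using cardSuc_greater[OF natLeq_Card_order] not_ordLess_ordLeq by blast
qed

definition zero_ordinal :: "omega1 \<Rightarrow> bool"
  where "zero_ordinal \<beta> \<longleftrightarrow> (\<forall>\<alpha>. \<beta> \<le> \<alpha>)"

definition successor_ordinal :: "omega1 \<Rightarrow> bool"
  where "successor_ordinal \<beta> \<longleftrightarrow> (\<exists>\<alpha><\<beta>. \<forall>\<gamma><\<beta>. \<gamma> \<le> \<alpha>)"

definition limit_ordinal :: "omega1 \<Rightarrow> bool"
  where "limit_ordinal \<beta> \<longleftrightarrow> \<not> zero_ordinal \<beta> \<and> \<not> successor_ordinal \<beta>"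

text \<open>The ordinal \<open>\<beta> - 1\<close>, meaningful for successor ordinals only.\<close>

definition pred_ordinal :: "omega1 \<Rightarrow> omega1"
  where "pred_ordinal \<beta> = (GREATEST \<alpha>. \<alpha> < \<beta>)"

lemma pred_ordinal_less: "successor_ordinal \<beta> \<Longrightarrow> pred_ordinal \<beta> < \<beta>"
  unfolding successor_ordinal_def pred_ordinal_def
  by (metis (mono_tags, lifting) Greatest_equality)

section \<open>The classes \<open>G\<^sub>\<delta>\<^sup>\<beta>\<close> and \<open>G\<^sub>\<delta>\<^sub>\<sigma>\<^sup>\<beta>\<close>\<close>

text \<open>As in the library definition of \<^const>\<open>gdelta_in\<close>, countable intersections are taken
  relative to the whole space, so that the empty one is the whole space. A limit stage is just
  the union of the earlier stages, for both classes.\<close>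

function G_delta :: "'b topology \<Rightarrow> omega1 \<Rightarrow> 'b set set"
  and G_delta_sigma :: "'b topology \<Rightarrow> omega1 \<Rightarrow> 'b set set"
  where
    "G_delta T \<beta> =
      (if limit_ordinal \<beta> then \<Union>\<alpha>\<in>{..<\<beta>}. G_delta T \<alpha>
       else if successor_ordinal \<beta> then
         Collect ((countable intersection_of (\<lambda>S. S \<in> G_delta_sigma T (pred_ordinal \<beta>)))
                    relative_to topspace T)
       else Collect (gdelta_in T))"
  | "G_delta_sigma T \<beta> =
      (if limit_ordinal \<beta> then \<Union>\<alpha>\<in>{..<\<beta>}. G_delta_sigma T \<alpha>
       else Collect (countable union_of (\<lambda>S. S \<in> G_delta T \<beta>)))"
  by pat_completeness auto
termination
proof (relation "inv_image ({(\<alpha>, \<beta>). \<alpha> < \<beta>} <*lex*> less_than)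
    (\<lambda>s. case s of Inl (T, \<beta>) \<Rightarrow> (\<beta>, 0::nat) | Inr (T, \<beta>) \<Rightarrow> (\<beta>, 1))")
  show "wf (inv_image ({(\<alpha>, \<beta>). \<alpha> < \<beta>} <*lex*> less_than)
    (\<lambda>s. case s of Inl (T :: 'b topology, \<beta> :: omega1) \<Rightarrow> (\<beta>, 0::nat)
                 | Inr (T :: 'b topology, \<beta>) \<Rightarrow> (\<beta>, 1)))"
    by (intro wf_inv_image wf_lex_prod wf wf_less_than)
qed (auto simp: pred_ordinal_less)

declare G_delta.simps [simp del] G_delta_sigma.simps [simp del]

section \<open>The space \<open>2\<^bsup>\<P>(X)\<^esup>\<close> and the topologies on \<open>X\<close>\<close>

text \<open>A family \<open>x \<in> \<P>(\<P>(X))\<close> is identified with its characteristic function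
  \<open>\<P>(X) \<rightarrow> 2\<close>, with \<open>2\<close> the discrete space of truth values.\<close>

definition family_space :: "'a set \<Rightarrow> 'a set set topology"
  where "family_space X =
    pullback_topology (Pow (Pow X)) (\<lambda>x. \<lambda>A\<in>Pow X. A \<in> x)
      (product_topology (\<lambda>_. discrete_topology (UNIV :: bool set)) (Pow X))"

lemma topspace_family_space: "topspace (family_space X) = Pow (Pow X)"
  by (auto simp: family_space_def topspace_pullback_topology)

lemma family_space_subbase:
  "family_space X = topology_generated_by
    (\<Union>A\<in>Pow X. {{x \<in> Pow (Pow X). A \<in> x}, {x \<in> Pow (Pow X). A \<notin> x}})"
  (is "_ = topology_generated_by ?B")
proof -
  let ?\<phi> = "\<lambda>x. \<lambda>A\<in>Pow X. A \<in> x"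
  let ?P = "product_topology (\<lambda>_. discrete_topology (UNIV :: bool set)) (Pow X)"
  have top: "topspace (topology_generated_by ?B) = Pow (Pow X)"
    unfolding topology_generated_by_topspace by auto
  have 1: "openin (family_space X) S" if "S \<in> ?B" for S
  proof -
    obtain A b where A: "A \<subseteq> X" and S: "S = {x \<in> Pow (Pow X). (A \<in> x) = b}"
    proof -
      from \<open>S \<in> ?B\<close> obtain A where A: "A \<subseteq> X"
        and S: "S = {x \<in> Pow (Pow X). A \<in> x} \<or> S = {x \<in> Pow (Pow X). A \<notin> x}"
        by blast
      from S show thesis
        using that[of A True, OF A] that[of A False, OF A] by auto
    qed
    have "openin ?P {f \<in> topspace ?P. f A \<in> {b}}"
    proof (rule openin_continuous_map_preimage)
      show "continuous_map ?P (discrete_topology UNIV) (\<lambda>f. f A)"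
        using A continuous_map_product_projection[of A "Pow X" "\<lambda>_. discrete_topology UNIV"]
        by simp
    qed simp
    moreover have "S = ?\<phi> -` {f \<in> topspace ?P. f A \<in> {b}} \<inter> Pow (Pow X)"
      using A by (auto simp: S)
    ultimately show ?thesis
      unfolding family_space_def openin_pullback_topology by blast
  qed
  have 2: "openin (family_space X) S" if "generate_topology_on ?B S" for S
    using that
  proof induction
    case (Basis S)
    then show ?case by (rule 1)
  qed auto
  have "continuous_map (topology_generated_by ?B) (discrete_topology UNIV) (\<lambda>x. ?\<phi> x A)"
    if A: "A \<in> Pow X" for A
  proof -
    have "openin (topology_generated_by ?B) {x \<in> Pow (Pow X). (A \<in> x) \<in> U}" for U
    proof -
      have p: "openin (topology_generated_by ?B) {x \<in> Pow (Pow X). A \<in> x}"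
        and n: "openin (topology_generated_by ?B) {x \<in> Pow (Pow X). A \<notin> x}"
        using A by (auto intro!: topology_generated_by_Basis)
      have "{x \<in> Pow (Pow X). (A \<in> x) \<in> U} =
          (if True \<in> U then {x \<in> Pow (Pow X). A \<in> x} else {}) \<union>
          (if False \<in> U then {x \<in> Pow (Pow X). A \<notin> x} else {})"
        by (auto split: if_splits) (metis (full_types))+
      then show ?thesis
        using p n by (simp add: openin_Un)
    qed
    then show ?thesis
      using A unfolding continuous_map_def top by simp
  qed
  then have cont: "continuous_map (topology_generated_by ?B) ?P ?\<phi>"
    by (subst continuous_map_componentwise) auto
  have 3: "openin (topology_generated_by ?B) S" if "openin (family_space X) S" for S
  proof -
    obtain U where U: "openin ?P U" and S: "S = ?\<phi> -` U \<inter> Pow (Pow X)"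
      using \<open>openin (family_space X) S\<close>
      unfolding family_space_def openin_pullback_topology by blast
    have "S = {x \<in> topspace (topology_generated_by ?B). ?\<phi> x \<in> U}"
      unfolding top S by auto
    then show ?thesis
      using openin_continuous_map_preimage[OF cont U] by simp
  qed
  show ?thesis
    unfolding topology_eq using 2 3 openin_topology_generated_by by blast
qed

text \<open>A topology on \<open>X\<close>, as a point of the space above, is its family of open sets.\<close>

definition Top :: "'a set \<Rightarrow> 'a set set set"
  where "Top X = {Collect (openin T) | T. topspace T = X}"

lemma mem_Top_iff:
  "\<tau> \<in> Top X \<longleftrightarrow> \<tau> \<subseteq> Pow X \<and> {} \<in> \<tau> \<and> X \<in> \<tau> \<and>
    (\<forall>U\<in>\<tau>. \<forall>V\<in>\<tau>. U \<inter> V \<in> \<tau>) \<and> (\<forall>\<U>\<subseteq>\<tau>. \<Union>\<U> \<in> \<tau>)"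
proof
  assume "\<tau> \<in> Top X"
  then show "\<tau> \<subseteq> Pow X \<and> {} \<in> \<tau> \<and> X \<in> \<tau> \<and>
    (\<forall>U\<in>\<tau>. \<forall>V\<in>\<tau>. U \<inter> V \<in> \<tau>) \<and> (\<forall>\<U>\<subseteq>\<tau>. \<Union>\<U> \<in> \<tau>)"
    unfolding Top_def by (auto dest: openin_subset)
next
  assume *: "\<tau> \<subseteq> Pow X \<and> {} \<in> \<tau> \<and> X \<in> \<tau> \<and>
    (\<forall>U\<in>\<tau>. \<forall>V\<in>\<tau>. U \<inter> V \<in> \<tau>) \<and> (\<forall>\<U>\<subseteq>\<tau>. \<Union>\<U> \<in> \<tau>)"
  then have "istopology (\<lambda>U. U \<in> \<tau>)"
    unfolding istopology_def by (simp add: subset_iff Ball_def)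
  then have o: "openin (topology (\<lambda>U. U \<in> \<tau>)) = (\<lambda>U. U \<in> \<tau>)"
    by (rule topology_inverse')
  then have "topspace (topology (\<lambda>U. U \<in> \<tau>)) = X"
    using * unfolding topspace_def by auto
  with o show "\<tau> \<in> Top X"
    unfolding Top_def by (metis (mono_tags, lifting) Collect_mem_eq mem_Collect_eq)
qed

end

theory Submission
  imports Defs
begin

text \<open>
  The whole hierarchy is generated from open sets by countable intersections and unions, without
  complements. A countable intersection of unions of \<open>G\<^sub>\<delta>\<close> sets is again a union of \<open>G\<^sub>\<delta>\<close> sets,
  since one may choose a \<open>G\<^sub>\<delta>\<close> neighbourhood of a given point in each of the countably many members
  and intersect these. So at every level \<open>\<beta>\<close> the sets are unions, possibly uncountable, of
  \<open>G\<^sub>\<delta>\<close> sets (\<open>G_delta_hierarchy_union_of_gdelta\<close>).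

  In \<open>2\<^bsup>\<P>(X)\<^esup>\<close> a basic open set restricts only finitely many coordinates, so a \<open>G\<^sub>\<delta>\<close> set around a
  point \<open>p\<close> contains all points that agree with \<open>p\<close> on some countable set of coordinates
  (\<open>gdelta_in_family_space_countable_support\<close>). If \<open>Top X\<close> were in the hierarchy, this would apply
  to it at the discrete topology \<open>\<P>(X)\<close>. But \<open>\<P>(X)\<close> is uncountable, so there is a coordinate \<open>A\<close>
  outside the countable set, and removing the single set \<open>A\<close> from the discrete topology
  destroys it: on an infinite \<open>X\<close> every set is a union or an intersection of other open sets
  (\<open>discrete_minus_one_not_Top\<close>).
\<close>

text \<open>The two classes are treated together by induction on \<open>\<beta>\<close>, because \<open>G_delta_sigma\<close> at \<open>\<beta>\<close>
  is defined from \<open>G_delta\<close> at the same \<open>\<beta>\<close>. The members have to be unions of arbitrary,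
  not just countable, families: distributing a countable intersection over countable unions gives a
  union over all choice functions, of which there may be continuum many.\<close>

lemma G_delta_hierarchy_union_of_gdelta:
  shows "S \<in> G_delta T \<beta> \<Longrightarrow> p \<in> S \<Longrightarrow> \<exists>G. gdelta_in T G \<and> p \<in> G \<and> G \<subseteq> S"
    and "S \<in> G_delta_sigma T \<beta> \<Longrightarrow> p \<in> S \<Longrightarrow> \<exists>G. gdelta_in T G \<and> p \<in> G \<and> G \<subseteq> S"
proof (induction \<beta> arbitrary: S rule: less_induct)
  case (less \<beta>)
  have delta: "\<exists>G. gdelta_in T G \<and> p \<in> G \<and> G \<subseteq> S"
    if S: "S \<in> G_delta T \<beta>" "p \<in> S" for S
  proof -
    consider "limit_ordinal \<beta>" | "\<not> limit_ordinal \<beta>" "successor_ordinal \<beta>"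
      | "\<not> limit_ordinal \<beta>" "\<not> successor_ordinal \<beta>"
      by blast
    then show ?thesis
    proof cases
      case 1
      then obtain \<alpha> where "\<alpha> < \<beta>" "S \<in> G_delta T \<alpha>"
        using S by (auto simp: G_delta.simps[of T \<beta>])
      then show ?thesis
        using less.IH(1) S by blast
    next
      case 2
      then obtain \<U> where \<U>: "countable \<U>" "\<U> \<subseteq> G_delta_sigma T (pred_ordinal \<beta>)"
          "S = topspace T \<inter> \<Inter>\<U>"
        using S by (auto simp: G_delta.simps[of T \<beta>] relative_to_def intersection_of_def)
      have "\<forall>U\<in>\<U>. \<exists>G. gdelta_in T G \<and> p \<in> G \<and> G \<subseteq> U"
        using less.IH(2)[OF pred_ordinal_less[OF 2(2)]] \<U> S by blast
      then obtain g where g: "\<And>U. U \<in> \<U> \<Longrightarrow> gdelta_in T (g U) \<and> p \<in> g U \<and> g U \<subseteq> U"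
        by metis
      \<comment> \<open>The whole space is added for the empty \<open>\<U>\<close>, whose intersection is unbounded.\<close>
      have "gdelta_in T (\<Inter>(insert (topspace T) (g ` \<U>)))"
        using \<U> g by (intro gdelta_in_Inter) auto
      then show ?thesis
        using \<U> g S by (intro exI[of _ "\<Inter>(insert (topspace T) (g ` \<U>))"]) fastforce
    next
      case 3
      then show ?thesis
        using S by (auto simp: G_delta.simps[of T \<beta>])
    qed
  qed
  have sigma: "\<exists>G. gdelta_in T G \<and> p \<in> G \<and> G \<subseteq> S"
    if S: "S \<in> G_delta_sigma T \<beta>" "p \<in> S" for S
  proof (cases "limit_ordinal \<beta>")
    case True
    then obtain \<alpha> where "\<alpha> < \<beta>" "S \<in> G_delta_sigma T \<alpha>"
      using S by (auto simp: G_delta_sigma.simps[of T \<beta>])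
    then show ?thesis
      using less.IH(2) S by blast
  next
    case False
    then obtain \<U> where "\<U> \<subseteq> G_delta T \<beta>" "S = \<Union>\<U>"
      using S by (auto simp: G_delta_sigma.simps[of T \<beta>] union_of_def)
    then obtain U where "U \<in> G_delta T \<beta>" "p \<in> U" "U \<subseteq> S"
      using S by blast
    then show ?thesis
      using delta by (meson order_trans)
  qed
  {
    case 1
    then show ?case by (rule delta)
  next
    case 2
    then show ?case by (rule sigma)
  }
qed

text \<open>Finitely many coordinates suffice, but countably many are all that survives the passage to
  \<open>G\<^sub>\<delta>\<close> sets.\<close>

lemma openin_family_space_countable_support:
  assumes "openin (family_space X) U" "p \<in> U"
  shows "\<exists>C. countable C \<and> (\<forall>q \<subseteq> Pow X. (\<forall>A\<in>C. A \<in> q \<longleftrightarrow> A \<in> p) \<longrightarrow> q \<in> U)"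
proof -
  have "generate_topology_on
      (\<Union>A\<in>Pow X. {{x \<in> Pow (Pow X). A \<in> x}, {x \<in> Pow (Pow X). A \<notin> x}}) U"
    using assms(1) by (simp add: family_space_subbase openin_topology_generated_by)
  then show ?thesis
    using assms(2)
  proof induction
    case Empty
    then show ?case by simp
  next
    case (Int U V)
    then obtain C D
      where "countable C" "\<forall>q \<subseteq> Pow X. (\<forall>A\<in>C. A \<in> q \<longleftrightarrow> A \<in> p) \<longrightarrow> q \<in> U"
        and "countable D" "\<forall>q \<subseteq> Pow X. (\<forall>A\<in>D. A \<in> q \<longleftrightarrow> A \<in> p) \<longrightarrow> q \<in> V"
      by auto
    then show ?case
      by (intro exI[of _ "C \<union> D"]) auto
  next
    case (UN K)
    then show ?case by (meson UnionE UnionI)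
  next
    case (Basis U)
    then obtain A where "U = {x \<in> Pow (Pow X). A \<in> x} \<or> U = {x \<in> Pow (Pow X). A \<notin> x}"
      by blast
    then show ?case
      using Basis.prems by (intro exI[of _ "{A}"]) auto
  qed
qed

lemma gdelta_in_family_space_countable_support:
  assumes "gdelta_in (family_space X) G" "p \<in> G"
  shows "\<exists>C. countable C \<and> (\<forall>q \<subseteq> Pow X. (\<forall>A\<in>C. A \<in> q \<longleftrightarrow> A \<in> p) \<longrightarrow> q \<in> G)"
proof -
  obtain \<U> where \<U>: "countable \<U>" "\<And>U. U \<in> \<U> \<Longrightarrow> openin (family_space X) U" "G = \<Inter>\<U>"
    using assms(1) by (auto simp: gdelta_in_alt intersection_of_def)
  have "\<exists>C. countable C \<and> (\<forall>q \<subseteq> Pow X. (\<forall>A\<in>C. A \<in> q \<longleftrightarrow> A \<in> p) \<longrightarrow> q \<in> U)"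
    if "U \<in> \<U>" for U
  proof (rule openin_family_space_countable_support)
    show "openin (family_space X) U"
      using that by (rule \<U>(2))
    show "p \<in> U"
      using that assms(2) \<U>(3) by simp
  qed
  then obtain c where c: "\<And>U. U \<in> \<U> \<Longrightarrow> countable (c U)"
      "\<And>U. U \<in> \<U> \<Longrightarrow> \<forall>q \<subseteq> Pow X. (\<forall>A\<in>c U. A \<in> q \<longleftrightarrow> A \<in> p) \<longrightarrow> q \<in> U"
    by metis
  show ?thesis
  proof (intro exI[of _ "\<Union>(c ` \<U>)"] conjI allI impI)
    show "countable (\<Union>(c ` \<U>))"
      using \<U>(1) c(1) by blast
    show "q \<in> G" if "q \<subseteq> Pow X" "\<forall>A\<in>\<Union>(c ` \<U>). A \<in> q \<longleftrightarrow> A \<in> p" for q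
      unfolding \<U>(3)
    proof (rule InterI)
      fix U assume "U \<in> \<U>"
      moreover from this have "\<forall>A\<in>c U. A \<in> q \<longleftrightarrow> A \<in> p"
        using that(2) by simp
      ultimately show "q \<in> U"
        using c(2) that(1) by simp
    qed
  qed
qed

lemma uncountable_Pow_infinite:
  assumes "infinite X"
  shows "uncountable (Pow X)"
proof
  assume "countable (Pow X)"
  then have "Pow X \<lesssim> (UNIV :: nat set)"
    by (auto simp: countable_def lepoll_def)
  also have "\<dots> \<lesssim> X"
    using assms by (simp add: infinite_le_lepoll)
  finally show False
    using lesspoll_Pow_self[of X] lepoll_antisym unfolding lesspoll_def by blast
qed

text \<open>A singleton \<open>{a}\<close> is recovered as \<open>{a, b} \<inter> {a, c}\<close>, and any other set as the union of its
  singletons. On a finite \<open>X\<close> the claim can fail: on two points, the Sierpinski topology is the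
  discrete one without a singleton.\<close>

lemma discrete_minus_one_not_Top:
  assumes "infinite X" "A \<subseteq> X"
  shows "Pow X - {A} \<notin> Top X"
proof
  assume "Pow X - {A} \<in> Top X"
  then have Int: "\<forall>U\<in>Pow X - {A}. \<forall>V\<in>Pow X - {A}. U \<inter> V \<in> Pow X - {A}"
    and Union: "\<forall>\<U>\<subseteq>Pow X - {A}. \<Union>\<U> \<in> Pow X - {A}"
    unfolding mem_Top_iff by argo+
  show False
  proof (cases "\<exists>a. A = {a}")
    case True
    then obtain a where a: "A = {a}" ..
    obtain b where b: "b \<in> X" "b \<noteq> a"
      using infinite_imp_nonempty[OF infinite_remove[OF assms(1), of a]] by auto
    obtain c where c: "c \<in> X" "c \<noteq> a" "c \<noteq> b"
      using infinite_imp_nonempty[OF infinite_remove[OF infinite_remove[OF assms(1), of a], of b]]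
      by auto
    have "{a, b} \<inter> {a, c} \<in> Pow X - {A}"
      using a b c assms(2) by (intro Int[rule_format]) auto
    moreover have "{a, b} \<inter> {a, c} = A"
      using a b c by auto
    ultimately show False
      by simp
  next
    case False
    have "\<Union>((\<lambda>a. {a}) ` A) \<in> Pow X - {A}"
      using False assms(2) by (intro Union[rule_format]) auto
    then show False
      by simp
  qed
qed

theorem corollary4p3:
  fixes X :: "'a set"
  assumes "infinite X"
  shows "\<forall>\<beta> :: omega1. Top X \<notin> G_delta (family_space X) \<beta>"
proof (intro allI notI)
  fix \<beta> assume Top: "Top X \<in> G_delta (family_space X) \<beta>"
  have "Pow X \<in> Top X"
    by (auto simp: mem_Top_iff)
  then obtain G where G: "gdelta_in (family_space X) G" "Pow X \<in> G" "G \<subseteq> Top X"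
    using G_delta_hierarchy_union_of_gdelta(1)[OF Top] by blast
  then obtain C where C: "countable C"
      "\<And>q. q \<subseteq> Pow X \<Longrightarrow> \<forall>A\<in>C. A \<in> q \<longleftrightarrow> A \<in> Pow X \<Longrightarrow> q \<in> G"
    using gdelta_in_family_space_countable_support by meson
  obtain A where A: "A \<subseteq> X" "A \<notin> C"
    using uncountable_Pow_infinite[OF assms] C(1) countable_subset[of "Pow X" C] by blast
  have "Pow X - {A} \<in> G"
    using A by (intro C(2)) auto
  then show False
    using G(3) discrete_minus_one_not_Top[OF assms A(1)] by blast
qed

end
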